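(* There exist a uniformly computable sequence $(N_i)_{i\in\mathbb{N}}$ of 0-sided martingales and a uniformly computable sequence $(T_i)_{i\in\mathbb{N}}$ of 1-sided martingales such that $\sum_i (N_i(\lambda)+T_i(\lambda))<\infty$ and the mixture $M=\sum_i (N_i+T_i)$ succeeds on every $X\in 2^{\omega}$ with $\dim(X)<1/2$.
   Context: $2^{<\omega}$ denotes the set of finite binary strings, $\lambda$ the empty string, $\sigma\ast i$ the extension of $\sigma$ by the bit $i$, and $X\restriction_n$ the first $n$ bits of $X\in 2^{\omega}$. A martingale is a function $M:2^{<\omega}\to\mathbb{R}^{\geq 0}$ with $2M(\sigma)=M(\sigma\ast 0)+M(\sigma\ast 1)$ for all $\sigma$. $M$ succeeds on $X$ if $\limsup_n M(X\restriction_n)=\infty$. $M$ is 0-sided if $M(\sigma\ast 0)\geq M(\sigma\ast 1)$ for all $\sigma$, and 1-sided if $M(\sigma\ast 1)\geq M(\sigma\ast 0)$ for all $\sigma$. The effective Hausdorff dimension of $X$ is $\dim(X)=\liminf_n K(X\restriction_n)/n$, where $K$ is prefix-free Kolmogorov complexity. *)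

theory Defs
  imports
    "HOL-Library.Nat_Bijection"
    "HOL-Library.Sublist"
    "HOL-Library.Extended_Nat"
    "HOL-Library.Extended_Real"
    "HOL-Library.Liminf_Limsup"
begin

section \<open>Partial computable functions\<close>

text \<open>Kleene's unbounded search: the least zero of \<open>p\<close>, provided that \<open>p\<close> is defined at all
  smaller arguments.\<close>

definition mu_search :: "(nat \<Rightarrow> nat option) \<Rightarrow> nat option" where
  "mu_search p =
    (if \<exists>n. p n = Some 0 \<and> (\<forall>m<n. p m \<noteq> None) then Some (LEAST n. p n = Some 0) else None)"

text \<open>The partial recursive functions in unary form: tuples of arguments are coded by the
  (primitive recursive) Cantor pairing \<^const>\<open>prod_encode\<close>, so that the projections are
  \<open>left\<close> and \<open>right\<close> and the identity is \<open>pair left right\<close>. The rule \<open>prec\<close> is primitive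
  recursion on the second component with the first as a parameter.\<close>

inductive partial_computable :: "(nat \<Rightarrow> nat option) \<Rightarrow> bool" where
  zero: "partial_computable (\<lambda>_. Some 0)"
| succ: "partial_computable (\<lambda>n. Some (Suc n))"
| left: "partial_computable (\<lambda>n. Some (fst (prod_decode n)))"
| right: "partial_computable (\<lambda>n. Some (snd (prod_decode n)))"
| pair: "partial_computable f \<Longrightarrow> partial_computable g \<Longrightarrow>
    partial_computable
      (\<lambda>n. Option.bind (f n) (\<lambda>a. Option.bind (g n) (\<lambda>b. Some (prod_encode (a, b)))))"
| comp: "partial_computable f \<Longrightarrow> partial_computable g \<Longrightarrow>
    partial_computable (\<lambda>n. Option.bind (g n) f)"
| prec: "partial_computable f \<Longrightarrow> partial_computable g \<Longrightarrow>
    partial_computable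
      (\<lambda>n. rec_nat (f (fst (prod_decode n)))
        (\<lambda>k r. Option.bind r
          (\<lambda>y. g (prod_encode (fst (prod_decode n), prod_encode (k, y)))))
        (snd (prod_decode n)))"
| search: "partial_computable f \<Longrightarrow>
    partial_computable (\<lambda>n. mu_search (\<lambda>k. f (prod_encode (n, k))))"

definition computable :: "(nat \<Rightarrow> nat) \<Rightarrow> bool" where
  "computable f \<longleftrightarrow> partial_computable (\<lambda>n. Some (f n))"

section \<open>Binary strings and infinite binary sequences\<close>

text \<open>Bit 1 is \<^const>\<open>True\<close>. The code of a string is its position in the length-lexicographic
  enumeration of all strings; in particular the coding is a bijection with \<^typ>\<open>nat\<close>.\<close>

definition string_code :: "bool list \<Rightarrow> nat" where
  "string_code \<sigma> = foldl (\<lambda>n b. 2 * n + 1 + of_bool b) 0 \<sigma>"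

definition initial_segment :: "(nat \<Rightarrow> bool) \<Rightarrow> nat \<Rightarrow> bool list" where
  "initial_segment X n = map X [0..<n]"

section \<open>Prefix-free complexity and effective Hausdorff dimension\<close>

type_synonym machine = "bool list \<Rightarrow> bool list option"

definition prefix_free_machine :: "machine \<Rightarrow> bool" where
  "prefix_free_machine V \<longleftrightarrow>
    (\<exists>f. partial_computable f \<and> (\<forall>\<sigma>. f (string_code \<sigma>) = map_option string_code (V \<sigma>))) \<and>
    (\<forall>\<sigma>\<in>dom V. \<forall>\<tau>\<in>dom V. prefix \<sigma> \<tau> \<longrightarrow> \<sigma> = \<tau>)"

text \<open>The infimum is \<open>\<infinity>\<close> if \<open>\<sigma>\<close> is not in the range of the machine.\<close>

definition complexity :: "machine \<Rightarrow> bool list \<Rightarrow> enat" where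
  "complexity V \<sigma> = (INF p \<in> {p. V p = Some \<sigma>}. enat (length p))"

text \<open>The prefix-free complexity \<open>K\<close> is \<^term>\<open>complexity U\<close> for an optimal prefix-free
  machine \<open>U\<close>; another choice of \<open>U\<close> changes it by at most an additive constant, and hence
  does not change the dimension.\<close>

definition optimal_prefix_free_machine :: "machine \<Rightarrow> bool" where
  "optimal_prefix_free_machine U \<longleftrightarrow>
    prefix_free_machine U \<and>
    (\<forall>V. prefix_free_machine V \<longrightarrow>
      (\<exists>c::nat. \<forall>\<sigma>. complexity U \<sigma> \<le> complexity V \<sigma> + enat c))"

definition effective_dim :: "machine \<Rightarrow> (nat \<Rightarrow> bool) \<Rightarrow> ereal" where
  "effective_dim U X =
    liminf (\<lambda>n. ereal_of_enat (complexity U (initial_segment X n)) / ereal (real n))"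

section \<open>Martingales\<close>

definition martingale :: "(bool list \<Rightarrow> real) \<Rightarrow> bool" where
  "martingale M \<longleftrightarrow>
    (\<forall>\<sigma>. 0 \<le> M \<sigma> \<and> 2 * M \<sigma> = M (\<sigma> @ [False]) + M (\<sigma> @ [True]))"

definition zero_sided :: "(bool list \<Rightarrow> real) \<Rightarrow> bool" where
  "zero_sided M \<longleftrightarrow> (\<forall>\<sigma>. M (\<sigma> @ [False]) \<ge> M (\<sigma> @ [True]))"

definition one_sided :: "(bool list \<Rightarrow> real) \<Rightarrow> bool" where
  "one_sided M \<longleftrightarrow> (\<forall>\<sigma>. M (\<sigma> @ [True]) \<ge> M (\<sigma> @ [False]))"

definition succeeds_on :: "(bool list \<Rightarrow> real) \<Rightarrow> (nat \<Rightarrow> bool) \<Rightarrow> bool" where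
  "succeeds_on M X \<longleftrightarrow> limsup (\<lambda>n. ereal (M (initial_segment X n))) = \<infinity>"

text \<open>The values are computable reals, uniformly in the index and the string: from \<open>i\<close>, \<open>\<sigma>\<close>
  and \<open>k\<close> one computes the (signed) numerator of a dyadic rational with denominator \<open>2^k\<close>
  within distance \<open>2^-k\<close> of the value.\<close>

definition uniformly_computable :: "(nat \<Rightarrow> bool list \<Rightarrow> real) \<Rightarrow> bool" where
  "uniformly_computable N \<longleftrightarrow>
    (\<exists>f. computable f \<and>
      (\<forall>i \<sigma> k.
        \<bar>N i \<sigma> - real_of_int (int_decode (f (prod_encode (i, prod_encode (string_code \<sigma>, k))))) / 2 ^ k\<bar>
          \<le> 1 / 2 ^ k))"

end

theory Submission
  imports Defs
begin

text \<open>If \<open>U\<close> outputs \<open>\<tau>\<close> on the program \<open>p\<close>, reserve the capital \<open>2 ^ (- length p)\<close> for a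
  0-sided bettor that stakes everything at each 0 along \<open>\<tau>\<close>, and the same capital for a 1-sided
  bettor that does so at each 1. At \<open>\<tau>\<close> they hold \<open>2 ^ (z - length p)\<close> and
  \<open>2 ^ (o - length p)\<close>, where \<open>z\<close> and \<open>o\<close> count the zeros and ones of \<open>\<tau>\<close>; since one of \<open>z\<close>
  and \<open>o\<close> is at least \<open>length \<tau> / 2\<close>, the mixture is unbounded along every \<open>X\<close> of dimension
  below \<open>1/2\<close>. The total capital is finite by the Kraft inequality, and the bettors become
  uniformly computable when they are indexed by a program together with the stage at which it is
  first seen to halt.\<close>

section \<open>Computable functions\<close>

lemma computable_const: "computable (\<lambda>_. c)"
proof (induction c)
  case 0
  show ?case unfolding computable_def by (rule partial_computable.zero)
next
  case (Suc c)
  then show ?case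
    using partial_computable.comp[OF partial_computable.succ] by (fastforce simp: computable_def)
qed

lemma computable_comp:
  assumes "computable f" "computable g"
  shows "computable (\<lambda>n. f (g n))"
  using partial_computable.comp[OF assms[unfolded computable_def]] by (simp add: computable_def)

lemma computable_Suc: "computable f \<Longrightarrow> computable (\<lambda>n. Suc (f n))"
  using computable_comp[of Suc] partial_computable.succ by (simp add: computable_def)

lemma computable_fst: "computable f \<Longrightarrow> computable (\<lambda>n. fst (prod_decode (f n)))"
  using computable_comp[of "\<lambda>n. fst (prod_decode n)"] partial_computable.left
  by (simp add: computable_def)

lemma computable_snd: "computable f \<Longrightarrow> computable (\<lambda>n. snd (prod_decode (f n)))"
  using computable_comp[of "\<lambda>n. snd (prod_decode n)"] partial_computable.right
  by (simp add: computable_def)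

lemma computable_pair:
  assumes "computable f" "computable g"
  shows "computable (\<lambda>n. prod_encode (f n, g n))"
  using partial_computable.pair[OF assms[unfolded computable_def]] by (simp add: computable_def)

lemma computable_id: "computable (\<lambda>n. n)"
  using partial_computable.pair[OF partial_computable.left partial_computable.right]
  by (simp add: computable_def)

definition computable2 :: "(nat \<Rightarrow> nat \<Rightarrow> nat) \<Rightarrow> bool" where
  "computable2 F \<longleftrightarrow> computable (\<lambda>n. F (fst (prod_decode n)) (snd (prod_decode n)))"

text \<open>The nesting (first, (second, third)) is the argument format of the step function in rule
  \<open>prec\<close>, and also that of the approximating function in
  \<open>uniformly_computable\<close>.\<close>

definition computable3 :: "(nat \<Rightarrow> nat \<Rightarrow> nat \<Rightarrow> nat) \<Rightarrow> bool" where
  "computable3 F \<longleftrightarrow>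
    computable (\<lambda>n. F (fst (prod_decode n)) (fst (prod_decode (snd (prod_decode n))))
      (snd (prod_decode (snd (prod_decode n)))))"

lemma computable2_comp:
  assumes "computable2 F" "computable f" "computable g"
  shows "computable (\<lambda>n. F (f n) (g n))"
  using computable_comp[OF assms(1)[unfolded computable2_def] computable_pair[OF assms(2,3)]]
  by simp

text \<open>With total ingredients the option-valued recursion of \<open>prec\<close> never meets
  \<open>None\<close>, so it is \<open>Some\<close> of an ordinary recursion. Applying it to the
  pair of \<open>n\<close> and \<open>b n\<close> lets base and step depend on
  \<open>n\<close>.\<close>

lemma computable_rec:
  assumes a: "computable a" and G: "computable3 G" and b: "computable b"
  shows "computable (\<lambda>n. rec_nat (a n) (G n) (b n))"
proof -
  let ?g = "\<lambda>n. Some (G (fst (prod_decode n)) (fst (prod_decode (snd (prod_decode n))))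
      (snd (prod_decode (snd (prod_decode n)))))"
  have rec: "rec_nat (Some x) (\<lambda>k r. Option.bind r (\<lambda>y. ?g (prod_encode (m, prod_encode (k, y))))) l
      = Some (rec_nat x (G m) l)" for x m l
    by (induction l) auto
  have "computable (\<lambda>n. rec_nat (a (fst (prod_decode n))) (G (fst (prod_decode n)))
      (snd (prod_decode n)))"
    using partial_computable.prec[OF a[unfolded computable_def] G[unfolded computable3_def computable_def]]
    unfolding rec computable_def .
  from computable_comp[OF this computable_pair[OF computable_id b]] show ?thesis by simp
qed

lemma computable_recI:
  assumes "\<And>n. h n = rec_nat (a n) (G n) (b n)"
    and "computable a" "computable3 G" "computable b"
  shows "computable h"
  using computable_rec[OF assms(2-4)] by (simp flip: assms(1))

text \<open>Since \<open>P\<close> is total and has a zero, the definedness proviso of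
  \<open>mu_search\<close> is met.\<close>

lemma computable_Least:
  assumes P: "computable2 P" and ex: "\<And>n. \<exists>k. P n k = 0"
  shows "computable (\<lambda>n. LEAST k. P n k = 0)"
proof -
  have "mu_search (\<lambda>k. Some (P n k)) = Some (LEAST k. P n k = 0)" for n
    using ex[of n] by (simp add: mu_search_def)
  then show ?thesis
    using partial_computable.search[OF P[unfolded computable2_def computable_def]]
    by (simp add: computable_def)
qed

lemmas computable_basic = computable_const computable_id computable_Suc computable_fst
  computable_snd computable_pair

section \<open>Arithmetic by primitive recursion\<close>

lemma computable_add:
  assumes "computable f" "computable g"
  shows "computable (\<lambda>n. f n + g n)"
proof (rule computable_recI)
  have "x + m = rec_nat x (\<lambda>k y. Suc y) m" for x m :: nat by (induction m) auto
  then show "f n + g n = rec_nat (f n) (\<lambda>k y. Suc y) (g n)" for n .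
  show "computable3 (\<lambda>n k y. Suc y)"
    unfolding computable3_def by (intro computable_basic)
qed (fact assms)+

lemma computable_pred: "computable (\<lambda>n. n - 1)"
proof (rule computable_recI)
  show "m - 1 = rec_nat 0 (\<lambda>k y. k) m" for m :: nat by (cases m) auto
  show "computable3 (\<lambda>n k y. k)"
    unfolding computable3_def by (intro computable_basic)
qed (intro computable_basic)+

lemma computable_diff:
  assumes "computable f" "computable g"
  shows "computable (\<lambda>n. f n - g n)"
proof (rule computable_recI)
  have "x - m = rec_nat x (\<lambda>k y. y - 1) m" for x m :: nat by (induction m) auto
  then show "f n - g n = rec_nat (f n) (\<lambda>k y. y - 1) (g n)" for n .
  show "computable3 (\<lambda>n k y. y - 1)"
    unfolding computable3_def by (intro computable_comp[OF computable_pred] computable_basic)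
qed (fact assms)+

lemma computable_mult:
  assumes "computable f" "computable g"
  shows "computable (\<lambda>n. f n * g n)"
proof (rule computable_recI)
  have "x * m = rec_nat 0 (\<lambda>k y. y + x) m" for x m :: nat by (induction m) auto
  then show "f n * g n = rec_nat 0 (\<lambda>k y. y + f n) (g n)" for n .
  show "computable3 (\<lambda>n k y. y + f n)"
    unfolding computable3_def by (intro computable_add computable_comp[OF assms(1)] computable_basic)
qed (fact assms computable_const)+

lemma computable_power:
  assumes "computable f" "computable g"
  shows "computable (\<lambda>n. f n ^ g n)"
proof (rule computable_recI)
  have "x ^ m = rec_nat 1 (\<lambda>k y. y * x) m" for x m :: nat by (induction m) auto
  then show "f n ^ g n = rec_nat 1 (\<lambda>k y. y * f n) (g n)" for n .
  show "computable3 (\<lambda>n k y. y * f n)"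
    unfolding computable3_def by (intro computable_mult computable_comp[OF assms(1)] computable_basic)
qed (fact assms computable_const)+

lemma computable_prod:
  assumes "computable2 f" "computable g"
  shows "computable (\<lambda>n. \<Prod>j<g n. f n j)"
proof (rule computable_recI)
  have "(\<Prod>j<m. f n j) = rec_nat 1 (\<lambda>k y. y * f n k) m" for n m :: nat by (induction m) auto
  then show "(\<Prod>j<g n. f n j) = rec_nat 1 (\<lambda>k y. y * f n k) (g n)" for n .
  show "computable3 (\<lambda>n k y. y * f n k)"
    unfolding computable3_def by (intro computable_mult computable2_comp[OF assms(1)] computable_basic)
qed (fact assms computable_const)+

lemma computable_iterate:
  assumes "computable f" "computable g" "computable h"
  shows "computable (\<lambda>n. (f ^^ g n) (h n))"
proof (rule computable_recI)
  have "(f ^^ m) x = rec_nat x (\<lambda>k y. f y) m" for x m :: nat by (induction m) auto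
  then show "(f ^^ g n) (h n) = rec_nat (h n) (\<lambda>k y. f y) (g n)" for n .
  show "computable3 (\<lambda>n k y. f y)"
    unfolding computable3_def by (intro computable_comp[OF assms(1)] computable_basic)
qed (fact assms)+

section \<open>Decidable predicates and searches over them\<close>

definition decidable :: "(nat \<Rightarrow> bool) \<Rightarrow> bool" where
  "decidable P \<longleftrightarrow> computable (\<lambda>n. of_bool (P n))"

lemma decidable_le:
  assumes "computable f" "computable g"
  shows "decidable (\<lambda>n. f n \<le> g n)"
proof -
  have "1 - (x - y) = of_bool (x \<le> y)" for x y :: nat by auto
  with computable_diff[OF computable_const computable_diff[OF assms]] show ?thesis
    by (metis (no_types, lifting) decidable_def ext)
qed

lemma decidable_not:
  assumes "decidable P"
  shows "decidable (\<lambda>n. \<not> P n)"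
proof -
  have "1 - of_bool b = (of_bool (\<not> b) :: nat)" for b by auto
  with computable_diff[OF computable_const assms[unfolded decidable_def]] show ?thesis
    by (metis (no_types, lifting) decidable_def ext)
qed

lemma decidable_conj:
  assumes "decidable P" "decidable Q"
  shows "decidable (\<lambda>n. P n \<and> Q n)"
  using computable_mult[OF assms[unfolded decidable_def]]
  by (simp add: decidable_def flip: of_bool_conj)

lemma decidable_disj:
  assumes "decidable P" "decidable Q"
  shows "decidable (\<lambda>n. P n \<or> Q n)"
  using decidable_not[OF decidable_conj[OF assms[THEN decidable_not]]] by simp

lemma decidable_eq:
  assumes "computable f" "computable g"
  shows "decidable (\<lambda>n. f n = g n)"
  using decidable_conj[OF decidable_le[OF assms] decidable_le[OF assms(2,1)]]
  by (simp add: eq_iff)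

lemma computable_if:
  assumes "decidable P" "computable f" "computable g"
  shows "computable (\<lambda>n. if P n then f n else g n)"
proof -
  have "(if b then x else y) = of_bool b * x + (1 - of_bool b) * y" for b and x y :: nat by auto
  moreover have "computable (\<lambda>n. of_bool (P n) * f n + (1 - of_bool (P n)) * g n)"
    using assms(1)[unfolded decidable_def]
    by (intro computable_add computable_mult computable_diff computable_const assms)
  ultimately show ?thesis by simp
qed

lemma computable_Least_decidable:
  assumes P: "decidable (\<lambda>z. P (fst (prod_decode z)) (snd (prod_decode z)))"
    and ex: "\<And>n. \<exists>k. P n k"
  shows "computable (\<lambda>n. LEAST k. P n k)"
  using computable_Least[of "\<lambda>n k. of_bool (\<not> P n k)"] decidable_not[OF P] ex
  by (simp add: decidable_def computable2_def)

lemma computable_div: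
  assumes "computable f" "computable g" "\<And>n. g n > 0"
  shows "computable (\<lambda>n. f n div g n)"
proof -
  \<comment> \<open>The quotient is found by search as the least \<open>q\<close> with
    \<open>f n < (q + 1) * g n\<close>.\<close>
  have "(LEAST q. Suc (f n) \<le> Suc q * g n) = f n div g n" for n
  proof (rule Least_equality)
    show "Suc (f n) \<le> Suc (f n div g n) * g n"
      using dividend_less_div_times[OF assms(3)] by (metis Suc_leI mult_Suc)
  next
    fix q assume "Suc (f n) \<le> Suc q * g n"
    then have "f n div g n < Suc q" using assms(3)[of n] by (simp add: less_mult_imp_div_less)
    then show "f n div g n \<le> q" by simp
  qed
  \<comment> \<open>The witness \<open>q = f n\<close> shows that the search terminates, as
    \<open>g n\<close> is positive.\<close>
  moreover have "Suc (f n) \<le> Suc (f n) * g n" for n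
    using mult_le_mono2[of 1 "g n" "Suc (f n)"] assms(3)[of n] by simp
  moreover have "decidable (\<lambda>z. Suc (f (fst (prod_decode z)))
      \<le> Suc (snd (prod_decode z)) * g (fst (prod_decode z)))"
    by (intro decidable_le computable_mult computable_Suc computable_comp[OF assms(1)]
        computable_comp[OF assms(2)] computable_basic)
  ultimately show ?thesis
    using computable_Least_decidable[of "\<lambda>n q. Suc (f n) \<le> Suc q * g n"] by force
qed

section \<open>Stage approximations of partial computable functions\<close>

text \<open>Every partial computable function is approximated in stages by a total one; the value
  \<open>0\<close> means that no output has been found yet and \<open>Suc y\<close> that the output is \<open>y\<close>.\<close>

definition approximates :: "(nat \<Rightarrow> nat \<Rightarrow> nat) \<Rightarrow> (nat \<Rightarrow> nat option) \<Rightarrow> bool" where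
  "approximates G f \<longleftrightarrow> computable2 G \<and> (\<forall>n s y. G n s = Suc y \<longrightarrow> f n = Some y) \<and>
    (\<forall>n y. f n = Some y \<longrightarrow> (\<forall>\<^sub>F s in sequentially. G n s = Suc y))"

lemma approximates_total:
  assumes "computable g"
  shows "approximates (\<lambda>n s. Suc (g n)) (\<lambda>n. Some (g n))"
  unfolding approximates_def computable2_def
  by (auto intro!: computable_Suc computable_comp[OF assms] computable_fst computable_id)

text \<open>Both parts are run at one common stage. Completeness holds because a finite conjunction
  of eventual conditions is eventual; this is why \<open>approximates\<close> asks for all large
  stages and not for some stage.\<close>

lemma approximates_pair:
  assumes "approximates F f" "approximates G g"
  shows "approximates
    (\<lambda>n s. if F n s = 0 \<or> G n s = 0 then 0 else Suc (prod_encode (F n s - 1, G n s - 1)))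
    (\<lambda>n. Option.bind (f n) (\<lambda>a. Option.bind (g n) (\<lambda>b. Some (prod_encode (a, b)))))"
  unfolding approximates_def
proof (intro conjI allI impI)
  have FG: "computable2 F" "computable2 G" using assms by (auto simp: approximates_def)
  show "computable2 (\<lambda>n s. if F n s = 0 \<or> G n s = 0 then 0 else Suc (prod_encode (F n s - 1, G n s - 1)))"
    unfolding computable2_def
    by (intro computable_if decidable_disj decidable_eq computable_diff computable2_comp[OF FG(1)]
        computable2_comp[OF FG(2)] computable_basic)
next
  fix n s y
  assume "(if F n s = 0 \<or> G n s = 0 then 0 else Suc (prod_encode (F n s - 1, G n s - 1))) = Suc y"
  moreover from this obtain a b where "F n s = Suc a" "G n s = Suc b"
    by (metis nat.exhaust nat.distinct(1))
  ultimately show "Option.bind (f n) (\<lambda>a. Option.bind (g n) (\<lambda>b. Some (prod_encode (a, b)))) = Some y"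
    using assms by (auto simp: approximates_def)
next
  fix n y
  assume "Option.bind (f n) (\<lambda>a. Option.bind (g n) (\<lambda>b. Some (prod_encode (a, b)))) = Some y"
  then obtain a b where ab: "f n = Some a" "g n = Some b" "y = prod_encode (a, b)"
    by (auto simp: bind_eq_Some_conv)
  then have "\<forall>\<^sub>F s in sequentially. F n s = Suc a" "\<forall>\<^sub>F s in sequentially. G n s = Suc b"
    using assms by (auto simp: approximates_def)
  then show "\<forall>\<^sub>F s in sequentially.
      (if F n s = 0 \<or> G n s = 0 then 0 else Suc (prod_encode (F n s - 1, G n s - 1))) = Suc y"
    by eventually_elim (simp add: ab)
qed

lemma approximates_comp:
  assumes "approximates F f" "approximates G g"
  shows "approximates (\<lambda>n s. if G n s = 0 then 0 else F (G n s - 1) s) (\<lambda>n. Option.bind (g n) f)"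
  unfolding approximates_def
proof (intro conjI allI impI)
  have FG: "computable2 F" "computable2 G" using assms by (auto simp: approximates_def)
  show "computable2 (\<lambda>n s. if G n s = 0 then 0 else F (G n s - 1) s)"
    unfolding computable2_def
    by (intro computable_if decidable_eq computable2_comp[OF FG(1)] computable_diff
        computable2_comp[OF FG(2)] computable_basic)
next
  fix n s y
  assume "(if G n s = 0 then 0 else F (G n s - 1) s) = Suc y"
  moreover from this obtain a where "G n s = Suc a"
    by (metis nat.exhaust nat.distinct(1))
  ultimately show "Option.bind (g n) f = Some y"
    using assms by (auto simp: approximates_def)
next
  fix n y
  assume "Option.bind (g n) f = Some y"
  then obtain a where a: "g n = Some a" "f a = Some y"
    by (auto simp: bind_eq_Some_conv)
  then have "\<forall>\<^sub>F s in sequentially. F a s = Suc y" "\<forall>\<^sub>F s in sequentially. G n s = Suc a"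
    using assms by (auto simp: approximates_def)
  then show "\<forall>\<^sub>F s in sequentially. (if G n s = 0 then 0 else F (G n s - 1) s) = Suc y"
    by eventually_elim (simp add: a)
qed

text \<open>The whole recursion is run at a fixed stage, and 0 propagates once a value is missing. A
  halting recursion makes only finitely many calls of \<open>f\<close> and \<open>g\<close>, so all
  of them succeed at late stages; this is the induction on \<open>l\<close>.\<close>

lemma approximates_prec:
  assumes "approximates F f" "approximates G g"
  shows "\<exists>H. approximates H (\<lambda>n. rec_nat (f (fst (prod_decode n)))
        (\<lambda>k r. Option.bind r
          (\<lambda>y. g (prod_encode (fst (prod_decode n), prod_encode (k, y)))))
        (snd (prod_decode n)))"
proof -
  define st where "st m s k r = (if r = 0 then 0 else G (prod_encode (m, prod_encode (k, r - 1))) s)"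
    for m s k r
  define h where "h m = rec_nat (f m)
      (\<lambda>k r. Option.bind r (\<lambda>y. g (prod_encode (m, prod_encode (k, y)))))" for m
  define H where "H m s = rec_nat (F m s) (st m s)" for m s
  have FG: "computable2 F" "computable2 G" using assms by (auto simp: approximates_def)
  have "computable2 (\<lambda>n s. H (fst (prod_decode n)) s (snd (prod_decode n)))"
    unfolding computable2_def H_def
    by (rule computable_rec) (unfold st_def computable3_def, (intro computable_if decidable_eq computable_diff
      computable2_comp[OF FG(1)] computable2_comp[OF FG(2)] computable_basic)+)
  moreover have "H m s l = Suc y \<Longrightarrow> h m l = Some y" for m s l y
  proof (induction l arbitrary: y)
    case 0
    then show ?case using assms(1) by (auto simp: H_def h_def approximates_def)
  next
    case (Suc l)
    then obtain x where x: "H m s l = Suc x" "G (prod_encode (m, prod_encode (l, x))) s = Suc y"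
      by (cases "H m s l") (auto simp: H_def st_def)
    with Suc.IH[of x] show ?case using assms(2) by (auto simp: h_def approximates_def)
  qed
  moreover have "h m l = Some y \<Longrightarrow> \<forall>\<^sub>F s in sequentially. H m s l = Suc y" for m l y
  proof (induction l arbitrary: y)
    case 0
    then show ?case using assms(1) by (auto simp: H_def h_def approximates_def)
  next
    case (Suc l)
    then obtain x where x: "h m l = Some x" "g (prod_encode (m, prod_encode (l, x))) = Some y"
      by (auto simp: h_def bind_eq_Some_conv)
    have "\<forall>\<^sub>F s in sequentially. G (prod_encode (m, prod_encode (l, x))) s = Suc y"
      using x(2) assms(2) by (auto simp: approximates_def)
    with Suc.IH[OF x(1)] show ?case
      by eventually_elim (simp add: H_def st_def)
  qed
  ultimately show ?thesis
    unfolding approximates_def h_def by blast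
qed

lemma approximates_search:
  assumes "approximates F f"
  shows "\<exists>H. approximates H (\<lambda>n. mu_search (\<lambda>k. f (prod_encode (n, k))))"
proof -
  \<comment> \<open>Values of \<open>F\<close> are shifted by one, so \<open>\<le> 1\<close> means
    "no output yet" or "output 0". Every argument below \<open>b n s\<close> is thus certified to
    have a nonzero output. The disjunct \<open>s \<le> k\<close> makes the search terminate.\<close>
  define b where "b n s = (LEAST k. s \<le> k \<or> F (prod_encode (n, k)) s \<le> 1)" for n s
  define H where "H n s = (if F (prod_encode (n, b n s)) s = 1 then Suc (b n s) else 0)" for n s
  have F: "computable2 F" and sound: "\<And>n s y. F n s = Suc y \<Longrightarrow> f n = Some y"
    and complete: "\<And>n y. f n = Some y \<Longrightarrow> \<forall>\<^sub>F s in sequentially. F n s = Suc y"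
    using assms by (auto simp: approximates_def)
  have b: "computable2 b"
    unfolding computable2_def b_def
    by (intro computable_Least_decidable decidable_disj decidable_le computable2_comp[OF F] computable_basic)
      blast
  have "computable2 H"
    unfolding computable2_def H_def
    by (intro computable_if decidable_eq computable2_comp[OF F] computable2_comp[OF b] computable_basic)
  moreover have "mu_search (\<lambda>k. f (prod_encode (n, k))) = Some y" if "H n s = Suc y" for n s y
  proof -
    have y: "y = b n s" "F (prod_encode (n, y)) s = 1"
      using that by (auto simp: H_def split: if_splits)
    have 0: "f (prod_encode (n, y)) = Some 0" using sound y(2) by simp
    have 1: "\<exists>x. f (prod_encode (n, m)) = Some (Suc x)" if "m < y" for m
    proof -
      have "\<not> F (prod_encode (n, m)) s \<le> 1"
        using not_less_Least that unfolding y(1) b_def by blast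
      then obtain x where "F (prod_encode (n, m)) s = Suc (Suc x)"
        by (metis One_nat_def Suc_le_mono le_zero_eq nat_le_linear not0_implies_Suc)
      then show ?thesis using sound by blast
    qed
    have "(LEAST k. f (prod_encode (n, k)) = Some 0) = y"
      using 0 1 by (intro Least_equality) (force simp: not_less[symmetric])+
    moreover have "\<exists>k. f (prod_encode (n, k)) = Some 0 \<and> (\<forall>m<k. f (prod_encode (n, m)) \<noteq> None)"
      using 0 1 by (intro exI[of _ y]) force
    ultimately show ?thesis by (simp add: mu_search_def)
  qed
  moreover have "\<forall>\<^sub>F s in sequentially. H n s = Suc y"
    if "mu_search (\<lambda>k. f (prod_encode (n, k))) = Some y" for n y
  proof -
    let ?p = "\<lambda>k. f (prod_encode (n, k))"
    have ex: "\<exists>k. ?p k = Some 0 \<and> (\<forall>m<k. ?p m \<noteq> None)"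
      using that unfolding mu_search_def by (metis (no_types, lifting) option.distinct(1))
    have y: "y = (LEAST k. ?p k = Some 0)"
      using that unfolding mu_search_def if_P[OF ex] by simp
    from ex obtain k where k: "?p k = Some 0" "\<forall>m<k. ?p m \<noteq> None" by blast
    have y0: "?p y = Some 0" unfolding y by (rule LeastI[of "\<lambda>k. ?p k = Some 0", OF k(1)])
    have "y \<le> k" unfolding y by (rule Least_le[of "\<lambda>k. ?p k = Some 0", OF k(1)])
    have "\<exists>x. ?p m = Some (Suc x)" if "m < y" for m
    proof -
      have "?p m \<noteq> Some 0" using that not_less_Least unfolding y by blast
      moreover have "?p m \<noteq> None" using k(2) that \<open>y \<le> k\<close> by simp
      ultimately show ?thesis by (metis not0_implies_Suc option.exhaust)
    qed
    then obtain x where x: "\<And>m. m < y \<Longrightarrow> ?p m = Some (Suc (x m))" by metis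
    \<comment> \<open>Only finitely many arguments precede \<open>y\<close>, so one late stage
      serves them all.\<close>
    have "\<forall>\<^sub>F s in sequentially. \<forall>m\<in>{..<y}. F (prod_encode (n, m)) s = Suc (Suc (x m))"
      using complete x by (intro eventually_ball_finite) auto
    moreover have "\<forall>\<^sub>F s in sequentially. F (prod_encode (n, y)) s = 1"
      using complete[OF y0] by simp
    \<comment> \<open>A stage of at least \<open>y\<close> keeps the cutoff in \<open>b\<close> from
      ending the search before \<open>y\<close>.\<close>
    moreover have "\<forall>\<^sub>F s in sequentially. y \<le> s" by (rule eventually_ge_at_top)
    ultimately show ?thesis
    proof eventually_elim
      case (elim s)
      have "b n s = y" unfolding b_def
        using elim by (intro Least_equality) (force simp: not_less[symmetric])+
      then show ?case using elim by (simp add: H_def)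
    qed
  qed
  ultimately show ?thesis unfolding approximates_def by blast
qed

text \<open>The induction over the generation rules takes the place of simulating a machine step by
  step.\<close>

theorem partial_computable_approximates: "partial_computable f \<Longrightarrow> \<exists>G. approximates G f"
proof (induction rule: partial_computable.induct)
  case zero
  show ?case using approximates_total[OF computable_const] by blast
next
  case succ
  show ?case using approximates_total[OF computable_Suc[OF computable_id]] by blast
next
  case left
  show ?case using approximates_total[OF computable_fst[OF computable_id]] by blast
next
  case right
  show ?case using approximates_total[OF computable_snd[OF computable_id]] by blast
next
  case pair
  then show ?case using approximates_pair by blast
next
  case comp
  then show ?case using approximates_comp by blast
next
  case prec
  then show ?case using approximates_prec by blast
next
  case search
  then show ?case using approximates_search by blast
qed

section \<open>Binary strings\<close>

lemma string_code_Nil [simp]: "string_code [] = 0"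
  by (simp add: string_code_def)

lemma string_code_snoc [simp]: "string_code (\<sigma> @ [b]) = 2 * string_code \<sigma> + 1 + of_bool b"
  by (simp add: string_code_def)

lemma string_code_eq_0_iff [simp]: "string_code \<sigma> = 0 \<longleftrightarrow> \<sigma> = []"
  by (cases \<sigma> rule: rev_cases) auto

text \<open>The parity of a nonzero code gives the last bit: odd for \<open>False\<close>, even for
  \<open>True\<close>. Halving then recovers the code of the rest.\<close>

lemma inj_string_code: "inj string_code"
proof (rule injI)
  show "\<sigma> = \<tau>" if "string_code \<sigma> = string_code \<tau>" for \<sigma> \<tau>
    using that
  proof (induction \<sigma> arbitrary: \<tau> rule: rev_induct)
    case Nil
    then show ?case by (metis string_code_Nil string_code_eq_0_iff)
  next
    case (snoc b \<sigma>)
    then obtain c \<rho> where \<tau>: "\<tau> = \<rho> @ [c]" by (cases \<tau> rule: rev_cases) auto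
    with snoc.prems have eq: "2 * string_code \<sigma> + of_bool b = 2 * string_code \<rho> + of_bool c" by simp
    then have "b = c" by (cases b; cases c) (simp_all, presburger+)
    with eq snoc.IH[of \<rho>] \<tau> show ?case by simp
  qed
qed

lemma surj_string_code: "surj string_code"
proof -
  have "\<exists>\<sigma>. n = string_code \<sigma>" for n
  proof (induction n rule: less_induct)
    case (less n)
    show ?case
    proof (cases "n = 0")
      case True
      then show ?thesis by (metis string_code_Nil)
    next
      case False
      then have "(n - 1) div 2 < n" by linarith
      then obtain \<sigma> where \<sigma>: "(n - 1) div 2 = string_code \<sigma>" using less by blast
      have "n = string_code (\<sigma> @ [even n])" using False unfolding string_code_snoc \<sigma>[symmetric] by (cases "even n") (auto elim!: evenE oddE)
      then show ?thesis by blast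
    qed
  qed
  then show ?thesis by blast
qed

section \<open>Decoding, and prefixes and lengths computed on codes\<close>

definition string_decode :: "nat \<Rightarrow> bool list" where
  "string_decode = inv string_code"

lemma string_decode_inverse [simp]: "string_code (string_decode n) = n"
  by (simp add: string_decode_def surj_f_inv_f surj_string_code)

lemma string_code_inverse [simp]: "string_decode (string_code \<sigma>) = \<sigma>"
  by (simp add: string_decode_def inj_string_code)

lemma string_code_eq_iff [simp]: "string_code \<sigma> = string_code \<tau> \<longleftrightarrow> \<sigma> = \<tau>"
  by (simp add: inj_string_code inj_eq)

text \<open>This is \<open>butlast\<close> on codes: \<open>2 * c + 1\<close> and
  \<open>2 * c + 2\<close> both go to \<open>c\<close>, and truncated subtraction fixes the code 0
  of the empty string.\<close>

definition code_init :: "nat \<Rightarrow> nat" where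
  "code_init c = (c - 1) div 2"

lemma string_code_butlast: "string_code (butlast \<sigma>) = code_init (string_code \<sigma>)"
  by (cases \<sigma> rule: rev_cases) (auto simp: code_init_def)

lemma string_code_take:
  "(code_init ^^ m) (string_code \<sigma>) = string_code (take (length \<sigma> - m) \<sigma>)"
proof (induction m)
  case (Suc m)
  have "length \<sigma> - Suc m = length \<sigma> - m - 1" by simp
  with Suc show ?case by (simp add: butlast_take flip: string_code_butlast)
qed simp

lemma computable_code_init_iterate: "computable2 (\<lambda>c m. (code_init ^^ m) c)"
  unfolding computable2_def code_init_def
  by (intro computable_iterate computable_div computable_diff computable_basic) simp

text \<open>The length is the number of bits to be dropped until the empty string, whose code is 0,
  is reached; a search finds it.\<close>

lemma computable_length:
  assumes "computable f"
  shows "computable (\<lambda>n. length (string_decode (f n)))"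
proof -
  have "length \<sigma> = (LEAST m. (code_init ^^ m) (string_code \<sigma>) = 0)" for \<sigma>
    by (rule sym, rule Least_equality) (auto simp: string_code_take)
  from this[of "string_decode _"]
  have "length (string_decode c) = (LEAST m. (code_init ^^ m) c = 0)" for c by simp
  moreover have "\<exists>m. (code_init ^^ m) c = 0" for c
    using string_code_take[of "length (string_decode c)" "string_decode c"] by auto
  ultimately have "computable (\<lambda>c. length (string_decode c))"
    using computable_Least[OF computable_code_init_iterate] by simp
  from computable_comp[OF this assms] show ?thesis .
qed

lemma computable_take:
  assumes "computable f" "computable g"
  shows "computable (\<lambda>n. string_code (take (f n) (string_decode (g n))))"
proof -
  \<comment> \<open>If \<open>k\<close> exceeds the length, truncated subtraction gives zero
    iterations, in agreement with \<open>take\<close>.\<close>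
  have "string_code (take k (string_decode c))
      = (code_init ^^ (length (string_decode c) - k)) c" for k c
    using string_code_take[of "length (string_decode c) - k" "string_decode c"]
    by (cases "k \<le> length (string_decode c)") auto
  moreover have "computable
      (\<lambda>n. (code_init ^^ (length (string_decode (g n)) - f n)) (g n))"
    by (intro computable2_comp[OF computable_code_init_iterate] computable_diff computable_length assms)
  ultimately show ?thesis by simp
qed

section \<open>Counting strings and the Kraft inequality\<close>

lemma card_bool_lists_length: "card {\<sigma> :: bool list. length \<sigma> = n} = 2 ^ n"
  using card_lists_length_eq[of "UNIV :: bool set" n] by simp

text \<open>Each string of \<open>F\<close> is extended in all ways to the maximal length
  \<open>n\<close>. Prefix-freeness makes the sets of extensions disjoint, and together they have at
  most \<open>2 ^ n\<close> members.\<close>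

lemma Kraft_inequality:
  fixes F :: "bool list set"
  assumes "finite F" and prefix_free: "\<And>\<sigma> \<tau>. \<sigma> \<in> F \<Longrightarrow> \<tau> \<in> F \<Longrightarrow> prefix \<sigma> \<tau> \<Longrightarrow> \<sigma> = \<tau>"
  shows "(\<Sum>\<sigma>\<in>F. (1 / 2) ^ length \<sigma>) \<le> (1 :: real)"
proof -
  define n where "n = Max (length ` F)"
  have n: "length \<sigma> \<le> n" if "\<sigma> \<in> F" for \<sigma> using that assms(1) by (simp add: n_def)
  define A where "A \<sigma> = (@) \<sigma> ` {\<rho> :: bool list. length \<rho> = n - length \<sigma>}" for \<sigma>
  have fin: "finite {\<rho> :: bool list. length \<rho> = m}" for m
    using finite_lists_length_eq[of "UNIV :: bool set" m] by simp
  have "card (A \<sigma>) = 2 ^ (n - length \<sigma>)" for \<sigma>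
    unfolding A_def by (subst card_image) (auto simp: inj_on_def card_bool_lists_length)
  moreover have "A \<sigma> \<inter> A \<tau> = {}" if "\<sigma> \<in> F" "\<tau> \<in> F" "\<sigma> \<noteq> \<tau>" for \<sigma> \<tau>
  proof (rule ccontr)
    assume "A \<sigma> \<inter> A \<tau> \<noteq> {}"
    then obtain \<rho> \<rho>' where "\<sigma> @ \<rho> = \<tau> @ \<rho>'" by (auto simp: A_def)
    then have "prefix \<sigma> \<tau> \<or> prefix \<tau> \<sigma>" by (metis prefixI prefix_same_cases)
    then show False using that prefix_free by blast
  qed
  ultimately have "(\<Sum>\<sigma>\<in>F. 2 ^ (n - length \<sigma>)) = card (\<Union>\<sigma>\<in>F. A \<sigma>)"
    using assms(1) fin by (subst card_UN_disjoint) (auto simp: A_def)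
  also have "\<dots> \<le> card {\<rho> :: bool list. length \<rho> = n}"
    using n fin by (intro card_mono) (auto simp: A_def)
  finally have "(\<Sum>\<sigma>\<in>F. 2 ^ (n - length \<sigma>)) \<le> (2 ^ n :: nat)"
    by (simp add: card_bool_lists_length)
  then have "real (\<Sum>\<sigma>\<in>F. 2 ^ (n - length \<sigma>)) \<le> real (2 ^ n)" by (rule of_nat_mono)
  moreover have "real (\<Sum>\<sigma>\<in>F. 2 ^ (n - length \<sigma>)) = 2 ^ n * (\<Sum>\<sigma>\<in>F. (1 / 2) ^ length \<sigma>)"
  proof -
    have "(2 :: real) ^ (n - length \<sigma>) = 2 ^ n * (1 / 2) ^ length \<sigma>" if "\<sigma> \<in> F" for \<sigma>
      using n[OF that] by (simp add: power_diff power_one_over)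
    then show ?thesis by (simp add: sum_distrib_left)
  qed
  ultimately show ?thesis by simp
qed

section \<open>Betting on one bit along a string\<close>

text \<open>The equation between prefixes says at once that \<open>\<sigma>\<close> has followed
  \<open>\<tau>\<close> for \<open>j\<close> bits, that \<open>\<tau>\<close> goes on, and that its
  next bit is \<open>b\<close>; otherwise nothing is staked. The product form makes computability a
  case of \<open>computable_prod\<close>.\<close>

definition bet :: "bool \<Rightarrow> bool list \<Rightarrow> bool list \<Rightarrow> nat" where
  "bet b \<tau> \<sigma> =
    (\<Prod>j<length \<sigma>. if take (Suc j) \<tau> = take j \<sigma> @ [b] then (if \<sigma> ! j = b then 2 else 0) else 1)"

lemma bet_Nil [simp]: "bet b \<tau> [] = 1"
  by (simp add: bet_def)

text \<open>The factors for the two possible next bits are 2 and 0 in favour of \<open>b\<close>, or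
  1 and 1. The martingale equation and the sidedness are read off from this.\<close>

lemma bet_snoc:
  "bet b \<tau> (\<sigma> @ [c]) =
    bet b \<tau> \<sigma> * (if take (Suc (length \<sigma>)) \<tau> = \<sigma> @ [b] then (if c = b then 2 else 0) else 1)"
proof -
  have "(\<Prod>j<length \<sigma>. if take (Suc j) \<tau> = take j \<sigma> @ [b]
      then (if (\<sigma> @ [c]) ! j = b then 2 else 0) else 1) = bet b \<tau> \<sigma>"
    unfolding bet_def by (intro prod.cong) (auto simp: nth_append)
  then show ?thesis by (simp add: bet_def[of b \<tau> "\<sigma> @ [c]"])
qed

text \<open>The arbitrary tail \<open>\<rho>\<close> lets the induction move the last bit of
  \<open>\<sigma>\<close> into it; the application takes \<open>\<rho>\<close> empty.\<close>

lemma bet_append_self: "bet b (\<sigma> @ \<rho>) \<sigma> = 2 ^ count_list \<sigma> b"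
proof (induction \<sigma> arbitrary: \<rho> rule: rev_induct)
  case (snoc c \<sigma>)
  then show ?case using snoc[of "c # \<rho>"] by (auto simp: bet_snoc)
qed simp

lemma bet_le: "bet b \<tau> \<sigma> \<le> 2 ^ length \<sigma>"
  by (induction \<sigma> rule: rev_induct) (auto simp: bet_snoc)

lemma computable_bet:
  assumes "computable f" "computable g"
  shows "computable (\<lambda>n. bet b (string_decode (f n)) (string_decode (g n)))"
proof -
  \<comment> \<open>All comparisons are made between codes. The bit \<open>\<sigma> ! j\<close> is
    tested by comparing the prefixes of lengths \<open>Suc j\<close> and \<open>j\<close>, which is
    valid because \<open>j\<close> is below the length.\<close>
  define F :: "nat \<Rightarrow> nat \<Rightarrow> nat" where "F n j = (if string_code (take (Suc j) (string_decode (f n)))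
        = 2 * string_code (take j (string_decode (g n))) + 1 + of_bool b
      then if string_code (take (Suc j) (string_decode (g n)))
          = 2 * string_code (take j (string_decode (g n))) + 1 + of_bool b then 2 else 0
      else 1)" for n j :: nat
  have "bet b (string_decode (f n)) (string_decode (g n)) = (\<Prod>j<length (string_decode (g n)). F n j)" for n
    unfolding bet_def F_def string_code_snoc[symmetric] string_code_eq_iff
    by (intro prod.cong) (auto simp: take_Suc_conv_app_nth)
  moreover have "computable2 F"
    unfolding computable2_def F_def
    by (intro computable_if decidable_eq computable_add computable_mult computable_take
        computable_comp[OF assms(1)] computable_comp[OF assms(2)] computable_basic)
  ultimately show ?thesis
    using computable_prod[OF _ computable_length[OF assms(2)]] by simp
qed

section \<open>The mixture\<close>

text \<open>The integer coding sends nonnegative integers to even numbers, so a natural numerator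
  has to be output as its double.\<close>

lemma int_decode_double: "int_decode (2 * m) = int m"
proof -
  have "int_encode (int m) = 2 * m" by (simp add: int_encode_def sum_encode_def)
  then show ?thesis by (metis int_encode_inverse)
qed

text \<open>The quotient is the floor of \<open>2 ^ k\<close> times the value, so the numerator is
  off by at most 1.\<close>

lemma dyadic_approximation:
  fixes m l k :: nat
  shows "\<bar>(1 / 2) ^ l * real m - real (m * 2 ^ k div 2 ^ l) / 2 ^ k\<bar> \<le> 1 / 2 ^ k"
proof -
  define x :: real where "x = real (m * 2 ^ k) / real (2 ^ l)"
  have "real (m * 2 ^ k div 2 ^ l) = of_int \<lfloor>x\<rfloor>"
    unfolding x_def floor_divide_of_nat_eq by simp
  then have "\<bar>x - real (m * 2 ^ k div 2 ^ l)\<bar> \<le> 1" by linarith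
  moreover have "(1 / 2) ^ l * real m - real (m * 2 ^ k div 2 ^ l) / 2 ^ k
      = (x - real (m * 2 ^ k div 2 ^ l)) / 2 ^ k"
    by (simp add: x_def field_simps)
  ultimately show ?thesis by (simp add: divide_right_mono)
qed

section \<open>Strategies indexed by programs and stages\<close>

locale approximated_machine =
  fixes U :: machine and f :: "nat \<Rightarrow> nat option" and G :: "nat \<Rightarrow> nat \<Rightarrow> nat"
  assumes prefix_free: "\<And>\<sigma> \<tau>. \<sigma> \<in> dom U \<Longrightarrow> \<tau> \<in> dom U \<Longrightarrow> prefix \<sigma> \<tau> \<Longrightarrow> \<sigma> = \<tau>"
    and graph: "\<And>\<sigma>. f (string_code \<sigma>) = map_option string_code (U \<sigma>)"
    and approximates: "approximates G f"
begin

text \<open>An index \<open>i\<close> codes a program and a stage. It is active if the stage is the first one at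
  which the program is seen to halt, so that every halting program has exactly one active index.\<close>

definition program :: "nat \<Rightarrow> bool list" where
  "program i = string_decode (fst (prod_decode i))"

definition stage :: "nat \<Rightarrow> nat" where
  "stage i = snd (prod_decode i)"

definition active :: "nat \<Rightarrow> bool" where
  "active i \<longleftrightarrow> G (string_code (program i)) (stage i) \<noteq> 0 \<and>
    (LEAST t. stage i \<le> t \<or> G (string_code (program i)) t \<noteq> 0) = stage i"

text \<open>The predecessor undoes the shift in \<open>G\<close>. Where \<open>G\<close> is 0 the
  default is the empty string, but such an index is inactive and its \<open>strategy\<close>
  vanishes.\<close>

definition out :: "nat \<Rightarrow> bool list" where
  "out i = string_decode (G (string_code (program i)) (stage i) - 1)"

text \<open>The zero martingale at inactive indices is both 0-sided and 1-sided, so all natural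
  numbers may serve as indices.\<close>

definition strategy :: "bool \<Rightarrow> nat \<Rightarrow> bool list \<Rightarrow> real" where
  "strategy b i \<sigma> = (if active i then (1 / 2) ^ length (program i) * real (bet b (out i) \<sigma>) else 0)"

lemma computable_G: "computable2 G"
  using approximates by (simp add: approximates_def)

lemma sound: "G (string_code p) s = Suc y \<Longrightarrow> U p = Some (string_decode y)"
  using approximates graph[of p] by (cases "U p") (auto simp: approximates_def)

lemma active_in_dom: "active i \<Longrightarrow> program i \<in> dom U"
  using sound not0_implies_Suc unfolding active_def by blast

text \<open>A program determines the stage of its active index, namely the first halting stage. The
  initial capitals are therefore summed over distinct programs, as the Kraft inequality
  requires.\<close>

lemma inj_on_program: "inj_on program {i. active i}"
proof (rule inj_onI)
  fix i j assume a: "i \<in> {i. active i}" "j \<in> {i. active i}" and p: "program i = program j"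
  have "\<not> stage i < stage j" if "active i" "active j" "program i = program j" for i j
    using that not_less_Least[of "stage i" "\<lambda>t. stage j \<le> t \<or> G (string_code (program j)) t \<noteq> 0"]
    by (auto simp: active_def)
  with a p have "stage i = stage j" by (metis linorder_neqE_nat mem_Collect_eq)
  moreover have "fst (prod_decode i) = fst (prod_decode j)"
    using p by (metis program_def string_decode_inverse)
  ultimately show "i = j"
    by (metis prod_decode_inverse prod_eq_iff stage_def)
qed

lemma ex_active:
  assumes "U p = Some \<tau>"
  obtains i where "active i" "program i = p" "out i = \<tau>"
proof -
  define s where "s = (LEAST s. G (string_code p) s \<noteq> 0)"
  have "\<forall>\<^sub>F s in sequentially. G (string_code p) s = Suc (string_code \<tau>)"
    using approximates graph[of p] assms by (simp add: approximates_def)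
  from eventually_happens'[OF sequentially_bot this]
  obtain s' where "G (string_code p) s' = Suc (string_code \<tau>)" by blast
  then have "G (string_code p) s' \<noteq> 0" by simp
  then have s: "G (string_code p) s \<noteq> 0" unfolding s_def by (rule LeastI)
  define i where "i = prod_encode (string_code p, s)"
  have i: "program i = p" "stage i = s" by (simp_all add: i_def program_def stage_def)
  have "(LEAST t. s \<le> t \<or> G (string_code p) t \<noteq> 0) = s"
    by (rule Least_equality) (auto simp: s_def Least_le)
  with s i have "active i" by (simp add: active_def)
  \<comment> \<open>Completeness speaks only of late stages, but soundness makes the output at the
    first halting stage \<open>s\<close> correct as well.\<close>
  moreover have "out i = \<tau>"
    using s i sound[of p s "G (string_code p) s - 1"] assms by (simp add: out_def)
  ultimately show thesis using that i by blast
qed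

lemma uniformly_computable_strategy: "uniformly_computable (strategy b)"
proof -
  have c_stage: "computable stage" and c_program: "computable (\<lambda>i. string_code (program i))"
    unfolding stage_def program_def string_decode_inverse by (intro computable_basic)+
  \<comment> \<open>The disjunct \<open>stage i \<le> t\<close> makes the search terminate even if
    the program never halts.\<close>
  have "computable (\<lambda>i. LEAST t. stage i \<le> t \<or> G (string_code (program i)) t \<noteq> 0)"
    by (intro computable_Least_decidable decidable_disj decidable_le decidable_not decidable_eq
        computable2_comp[OF computable_G] computable_comp[OF c_stage] computable_comp[OF c_program]
        computable_basic) blast
  then have "decidable active"
    unfolding active_def
    by (intro decidable_conj decidable_not decidable_eq computable2_comp[OF computable_G]
        c_stage c_program computable_const)
  then have c_active: "computable (\<lambda>i. of_bool (active i))" by (simp add: decidable_def)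
  have c_out: "computable (\<lambda>i. G (string_code (program i)) (stage i) - 1)"
    by (intro computable_diff computable2_comp[OF computable_G] c_stage c_program computable_const)
  have c_length: "computable (\<lambda>i. length (program i))"
    using computable_length[OF c_program] by simp
  \<comment> \<open>The factor 2 turns the numerator into an integer code; at inactive indices
    \<open>of_bool\<close> gives 0, the code of the integer 0.\<close>
  define h where "h i c k = of_bool (active i) *
      (2 * (bet b (out i) (string_decode c) * 2 ^ k div 2 ^ length (program i)))" for i c k
  have "computable3 h"
    unfolding computable3_def h_def out_def
    by (intro computable_mult computable_div computable_power computable_bet
        computable_comp[OF c_active] computable_comp[OF c_out] computable_comp[OF c_length]
        computable_basic) simp
  moreover have "\<bar>strategy b i \<sigma> - real_of_int (int_decode (h i (string_code \<sigma>) k)) / 2 ^ k\<bar> \<le> 1 / 2 ^ k"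
    for i \<sigma> k
    using int_decode_double[of 0] dyadic_approximation
    by (auto simp: strategy_def h_def int_decode_double)
  ultimately show ?thesis
    unfolding uniformly_computable_def computable3_def
    by (intro exI[of _ "\<lambda>n. h (fst (prod_decode n)) (fst (prod_decode (snd (prod_decode n))))
        (snd (prod_decode (snd (prod_decode n))))"] conjI) simp_all
qed

section \<open>Martingale property, sidedness and total capital\<close>

lemma strategy_nonneg: "0 \<le> strategy b i \<sigma>"
  by (simp add: strategy_def)

lemma martingale_strategy: "martingale (strategy b i)"
  unfolding martingale_def by (cases b) (auto simp: strategy_def bet_snoc)

lemma zero_sided_strategy: "zero_sided (strategy False i)"
  unfolding zero_sided_def by (auto simp: strategy_def bet_snoc)

lemma one_sided_strategy: "one_sided (strategy True i)"
  unfolding one_sided_def by (auto simp: strategy_def bet_snoc)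

lemma sum_strategy_Nil_le:
  assumes "finite I"
  shows "(\<Sum>i\<in>I. strategy b i []) \<le> 1"
proof -
  have "(\<Sum>i\<in>I. strategy b i []) = (\<Sum>i\<in>{i \<in> I. active i}. (1 / 2) ^ length (program i))"
    using assms by (simp add: strategy_def sum.inter_filter cong: if_cong)
  also have "\<dots> = (\<Sum>p\<in>program ` {i \<in> I. active i}. (1 / 2) ^ length p)"
    by (subst sum.reindex) (auto intro: inj_on_subset[OF inj_on_program])
  also have "\<dots> \<le> 1"
    using assms prefix_free active_in_dom by (intro Kraft_inequality) auto
  finally show ?thesis .
qed

text \<open>The capital at most doubles per bit, which gives the dominating series. Summability at
  every string, and not just at the empty one, makes the infinite sum in \<open>mixture\<close>
  meaningful.\<close>

lemma summable_strategy: "summable (\<lambda>i. strategy b i \<sigma>)"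
proof (rule summable_comparison_test')
  show "summable (\<lambda>i. 2 ^ length \<sigma> * strategy b i [])"
    by (intro summable_mult summableI_nonneg_bounded[where x = 1])
      (auto simp: strategy_nonneg sum_strategy_Nil_le)
  have "real (bet b \<tau> \<sigma>) \<le> 2 ^ length \<sigma>" for \<tau>
    by (simp add: bet_le)
  then show "norm (strategy b i \<sigma>) \<le> 2 ^ length \<sigma> * strategy b i []" for i
    by (simp add: strategy_def)
qed

section \<open>Success of the mixture in dimension below 1/2\<close>

definition mixture :: "bool list \<Rightarrow> real" where
  "mixture \<sigma> = (\<Sum>i. strategy False i \<sigma> + strategy True i \<sigma>)"

text \<open>One of the two bits makes up at least half of \<open>\<sigma>\<close>, so betting on it along \<open>\<sigma>\<close> multiplies
  the capital by at least \<open>2 ^ (length \<sigma> / 2)\<close>; a linear lower bound is all that is needed.\<close>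

lemma mixture_ge:
  assumes "U p = Some \<sigma>"
  shows "real (length \<sigma>) / 2 - real (length p) \<le> mixture \<sigma>"
proof -
  obtain i where i: "active i" "program i = p" "out i = \<sigma>" using ex_active[OF assms] .
  have count: "count_list \<sigma> False + count_list \<sigma> True = length \<sigma>" by (induction \<sigma>) auto
  have "real (length \<sigma>) / 2 \<le> real (count_list \<sigma> False)
      \<or> real (length \<sigma>) / 2 \<le> real (count_list \<sigma> True)"
    unfolding count[symmetric] by (simp add: field_simps linear)
  then obtain b where b: "real (length \<sigma>) / 2 \<le> real (count_list \<sigma> b)" by blast
  have "real m - real l \<le> (1 / 2) ^ l * 2 ^ m" for m l :: nat
  proof (cases "l \<le> m")
    case True
    have "real (m - l) \<le> 2 ^ (m - l)" by (rule less_imp_le[OF of_nat_less_two_power])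
    with True show ?thesis by (simp add: of_nat_diff power_diff power_one_over divide_simps)
  next
    case False
    then have "real m - real l \<le> 0" by simp
    also have "0 \<le> (1 / 2 :: real) ^ l * 2 ^ m" by simp
    finally show ?thesis .
  qed
  from this[of "count_list \<sigma> b" "length p"] b
  have "real (length \<sigma>) / 2 - real (length p) \<le> strategy b i \<sigma>"
    using i bet_append_self[of b \<sigma> "[]"] by (simp add: strategy_def)
  also have "\<dots> \<le> strategy False i \<sigma> + strategy True i \<sigma>"
    using strategy_nonneg by (cases b) auto
  also have "\<dots> \<le> mixture \<sigma>"
    unfolding mixture_def
    using sum_le_suminf[OF summable_add[OF summable_strategy summable_strategy], of "{i}"]
    by (simp add: strategy_nonneg)
  finally show ?thesis .
qed

text \<open>For \<open>r\<close> strictly between the dimension and 1/2, infinitely many prefixes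
  have programs shorter than \<open>r * n\<close>, where \<open>n\<close> is their length; there the
  mixture is at least \<open>(1 / 2 - r) * n\<close>.\<close>

lemma mixture_succeeds:
  assumes "effective_dim U X < 1 / 2"
  shows "succeeds_on mixture X"
proof -
  let ?K = "\<lambda>n. ereal_of_enat (complexity U (initial_segment X n)) / ereal (real n)"
  obtain r where r: "liminf ?K < ereal r" "ereal r < 1 / 2"
    using ereal_dense2[OF assms] unfolding effective_dim_def by blast
  have r2: "r < 1 / 2" using r(2) by (simp add: one_ereal_def numeral_eq_ereal)
  \<comment> \<open>Negating the characterisation of lower bounds of a liminf gives some
    \<open>y\<close> below \<open>r\<close> that \<open>?K\<close> does not eventually exceed. If
    \<open>?K n\<close> were eventually at least \<open>r\<close>, it would eventually exceed
    \<open>y\<close>.\<close>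
  obtain y where y: "y < ereal r" "\<not> (\<forall>\<^sub>F n in sequentially. y < ?K n)"
    using r(1) le_Liminf_iff[of "ereal r" sequentially ?K] by (auto simp: not_le[symmetric])
  have freq: "\<exists>\<^sub>F n in sequentially. ?K n < ereal r"
    unfolding frequently_def
  proof
    assume "\<forall>\<^sub>F n in sequentially. \<not> ?K n < ereal r"
    then have "\<forall>\<^sub>F n in sequentially. y < ?K n"
    proof eventually_elim
      case (elim n)
      then have "ereal r \<le> ?K n" by (simp only: not_less)
      with y(1) show ?case by (rule less_le_trans)
    qed
    with y(2) show False by blast
  qed
  have ge: "(1 / 2 - r) * real n \<le> mixture (initial_segment X n)"
    if "?K n < ereal r" "0 < n" for n
  proof -
    let ?\<sigma> = "initial_segment X n"
    have "complexity U ?\<sigma> \<noteq> \<infinity>"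
    proof
      assume "complexity U ?\<sigma> = \<infinity>"
      then have "?K n = \<infinity>" using that(2) by simp
      with that(1) show False by simp
    qed
    \<comment> \<open>Over an empty set of programs the infimum would be infinite.\<close>
    then have "{p. U p = Some ?\<sigma>} \<noteq> {}"
      unfolding complexity_def by (metis Inf_empty image_empty top_enat_def)
    then obtain q where "U q = Some ?\<sigma>" by blast
    \<comment> \<open>A nonempty set of extended naturals contains its infimum, so the complexity is
      the length of an actual program.\<close>
    then have "complexity U ?\<sigma> \<in> (\<lambda>p. enat (length p)) ` {p. U p = Some ?\<sigma>}"
      unfolding complexity_def by (intro wellorder_InfI[of "enat (length q)"]) auto
    then obtain p where p: "U p = Some ?\<sigma>" "complexity U ?\<sigma> = enat (length p)" by blast
    have "real (length p) / real n < r" using that p(2) by simp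
    then have "real (length p) < r * real n" using that(2) by (simp add: pos_divide_less_eq)
    moreover have "length ?\<sigma> = n" by (simp add: initial_segment_def)
    ultimately show ?thesis using mixture_ge[OF p(1)] by (simp add: left_diff_distrib)
  qed
  \<comment> \<open>A limsup below \<open>B\<close> would keep the values eventually below
    \<open>B\<close>, whereas \<open>(1 / 2 - r) * n\<close> grows past \<open>B\<close> and bounds
    them from below infinitely often.\<close>
  have "ereal B \<le> limsup (\<lambda>n. ereal (mixture (initial_segment X n)))" for B
  proof (rule ccontr)
    assume "\<not> ?thesis"
    then have "\<forall>\<^sub>F n in sequentially. ereal (mixture (initial_segment X n)) < ereal B"
      by (intro Limsup_lessD) (simp only: not_le)
    moreover have "\<forall>\<^sub>F n in sequentially. B \<le> (1 / 2 - r) * real n"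
    proof -
      obtain m where m: "B / (1 / 2 - r) \<le> real m" using real_arch_simple by blast
      have "B \<le> (1 / 2 - r) * real n" if "m \<le> n" for n
      proof -
        have "B \<le> (1 / 2 - r) * real m" using m r2 by (simp add: pos_divide_le_eq mult.commute)
        also have "\<dots> \<le> (1 / 2 - r) * real n" using that r2 by (intro mult_left_mono) auto
        finally show ?thesis .
      qed
      then show ?thesis by (auto simp: eventually_sequentially)
    qed
    moreover have "\<forall>\<^sub>F n in sequentially. 0 < n" by (rule eventually_gt_at_top)
    ultimately have "\<forall>\<^sub>F n in sequentially. \<not> ?K n < ereal r"
    proof eventually_elim
      case (elim n)
      show ?case
      proof
        assume "?K n < ereal r"
        from ge[OF this \<open>0 < n\<close>] elim show False by simp
      qed
    qed
    with freq show False by (simp add: frequently_def)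
  qed
  then show ?thesis
    unfolding succeeds_on_def by (rule ereal_top)
qed

end

theorem theorem2p11:
  fixes U :: machine
  assumes "optimal_prefix_free_machine U"
  shows "\<exists>N T :: nat \<Rightarrow> bool list \<Rightarrow> real.
    uniformly_computable N \<and> (\<forall>i. martingale (N i) \<and> zero_sided (N i)) \<and>
    uniformly_computable T \<and> (\<forall>i. martingale (T i) \<and> one_sided (T i)) \<and>
    summable (\<lambda>i. N i [] + T i []) \<and>
    (\<forall>X :: nat \<Rightarrow> bool. effective_dim U X < 1 / 2 \<longrightarrow>
      succeeds_on (\<lambda>\<sigma>. \<Sum>i. N i \<sigma> + T i \<sigma>) X)"
proof -
  obtain f where f: "partial_computable f" "\<And>\<sigma>. f (string_code \<sigma>) = map_option string_code (U \<sigma>)"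
    and pf: "\<And>\<sigma> \<tau>. \<sigma> \<in> dom U \<Longrightarrow> \<tau> \<in> dom U \<Longrightarrow> prefix \<sigma> \<tau> \<Longrightarrow> \<sigma> = \<tau>"
    using assms unfolding optimal_prefix_free_machine_def prefix_free_machine_def by blast
  \<comment> \<open>The stage approximation is taken of the function that computes \<open>U\<close>
    on codes.\<close>
  obtain G where "approximates G f" using partial_computable_approximates[OF f(1)] ..
  then interpret approximated_machine U f G
    using f(2) pf by unfold_locales
  show ?thesis
  proof (rule exI[of _ "strategy False"], rule exI[of _ "strategy True"], intro conjI allI impI)
    show "summable (\<lambda>i. strategy False i [] + strategy True i [])"
      by (intro summable_add summable_strategy)
    show "succeeds_on (\<lambda>\<sigma>. \<Sum>i. strategy False i \<sigma> + strategy True i \<sigma>) X"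
      if "effective_dim U X < 1 / 2" for X
      using mixture_succeeds[OF that] by (simp add: mixture_def[abs_def])
  qed (rule uniformly_computable_strategy martingale_strategy zero_sided_strategy one_sided_strategy)+
qed

end
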